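(* Let $X$ be a real Hilbert space, let $m\in\mathbb{N}$, let $S_1,\dots,S_m\subset X$ be nonempty closed convex sets with $\bigcap_{i=1}^m S_i=\emptyset$, and let $\alpha_i>0$, $i=1,\dots,m$, with $\sum_{i=1}^m\alpha_i=1$. Suppose that either $p>1$ and $m=2$, or $p\ge 2$. If the problem $$\underset{x\in X}{\text{minimize}}\ \sum_{i=1}^m\alpha_i\, d(x,S_i)^p$$ is solvable (i.e., has at least one optimal solution), then the problem $$\text{minimize } \|u\|_{\alpha,p}\quad\text{subject to } \bigcap_{i=1}^m (S_i+u_i)\neq\emptyset,\quad u=(u_1,\dots,u_m)\in X^m,$$ has a unique optimal solution.
   Context: $d(x,S_i)=\inf_{s\in S_i}\|x-s\|$ is the distance from $x$ to $S_i$ in the Hilbert norm $\|\cdot\|$. The weighted $p$-norm on $X^m$ is $\|u\|_{\alpha,p}=\left(\sum_{i=1}^m\alpha_i\|u_i\|^p\right)^{1/p}$. *)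

theory Defs
  imports "HOL-Analysis.Analysis"
begin

(* Elements of X^m are vectors 'a ^ 'm whose index type 'm has m elements.
   The library norm on 'a ^ 'm is the unweighted 2-norm; it is not used here. *)
definition weighted_pnorm ::
    "('m::finite \<Rightarrow> real) \<Rightarrow> real \<Rightarrow> 'a::real_normed_vector ^ 'm \<Rightarrow> real" where
  "weighted_pnorm \<alpha> p u = (\<Sum>i\<in>UNIV. \<alpha> i * norm (u $ i) powr p) powr (1 / p)"

definition distance_objective ::
    "('m::finite \<Rightarrow> real) \<Rightarrow> real \<Rightarrow> ('m \<Rightarrow> 'a::metric_space set) \<Rightarrow> 'a \<Rightarrow> real" where
  "distance_objective \<alpha> p S x = (\<Sum>i\<in>UNIV. \<alpha> i * infdist x (S i) powr p)"

definition feasible_shifts ::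
    "('m::finite \<Rightarrow> 'a::real_vector set) \<Rightarrow> ('a ^ 'm) set" where
  "feasible_shifts S = {u. (\<Inter>i. (\<lambda>s. s + u $ i) ` S i) \<noteq> {}}"

end

theory Submission
  imports Defs
begin

text \<open>
  Both problems are linked by eliminating the shifts. A vector \<open>u\<close> is feasible exactly when some
  point \<open>x\<close> satisfies \<open>x - u\<^sub>i \<in> S\<^sub>i\<close> for all \<open>i\<close>, and then \<open>d(x, S\<^sub>i) \<le> \<parallel>u\<^sub>i\<parallel>\<close>; so the distance
  objective at \<open>x\<close> bounds the \<open>p\<close>-th power of the norm of \<open>u\<close> from below. In a Hilbert space every
  distance to a nonempty closed convex set is attained (\<open>nearest_point_exists\<close>), so the bound is
  attained at the displacements from the nearest points to \<open>x\<close>. An optimal \<open>x\<close> therefore yields an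
  optimal \<open>u\<close>.

  Uniqueness comes from the shift problem itself, even though the distance problem may have many
  solutions: the feasible shifts form a convex set, and for \<open>p > 1\<close> the sum
  \<open>\<Sum>\<^sub>i \<alpha>\<^sub>i \<parallel>u\<^sub>i\<parallel>\<^sup>p\<close> is strictly convex. The latter combines strict convexity of \<open>t \<mapsto> t\<^sup>p\<close>, which
  separates vectors of different length, with the rotundity of the inner product norm, which
  separates different vectors of equal length (\<open>norm_midpoint_powr_less\<close>). Two distinct minimizers
  would thus be beaten by their midpoint.
\<close>

section \<open>Nearest points in Hilbert space\<close>

lemma parallelogram_midpoint:
  fixes x s t :: "'a::real_inner"
  shows "(dist s t)\<^sup>2 = 2 * (dist x s)\<^sup>2 + 2 * (dist x t)\<^sup>2 - 4 * (dist x (midpoint s t))\<^sup>2"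
  unfolding dist_norm midpoint_def power2_norm_eq_inner
  by (simp add: inner_simps inner_commute algebra_simps)

lemma midpoint_in_convex:
  assumes "convex S" "x \<in> S" "y \<in> S"
  shows "midpoint x y \<in> S"
  using closed_segment_subset[OF assms(2,3,1)] by (auto intro: midpoint_in_closed_segment)

text \<open>
  The points of \<open>S\<close> whose squared distance to \<open>x\<close> is within \<open>\<epsilon>\<close> of the infimum form closed nested
  sets. By the parallelogram law their diameters shrink to zero, because the midpoint of two such
  points lies in \<open>S\<close> and cannot be closer to \<open>x\<close> than the infimum; so completeness provides a point
  common to all of them.
\<close>

lemma nearest_point_exists:
  fixes S :: "'a::{real_inner, complete_space} set"
  assumes "S \<noteq> {}" "closed S" "convex S"
  obtains s where "s \<in> S" "dist x s = infdist x S"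
proof -
  define d where "d = infdist x S"
  define C where "C n = {s \<in> S. (dist x s)\<^sup>2 \<le> d\<^sup>2 + 1 / real (Suc n)}" for n :: nat
  have d0: "0 \<le> d" by (simp add: d_def infdist_nonneg)
  have "\<exists>a. \<forall>n. a \<in> C n"
  proof (rule decreasing_closed_nest[of C])
    fix n
    have "C n = S \<inter> {s. (dist x s)\<^sup>2 \<le> d\<^sup>2 + 1 / real (Suc n)}"
      by (auto simp: C_def)
    moreover have "closed {s. (dist x s)\<^sup>2 \<le> d\<^sup>2 + 1 / real (Suc n)}"
      by (intro closed_Collect_le continuous_intros)
    ultimately show "closed (C n)"
      using assms(2) closed_Int by metis
  next
    fix n
    have "d < sqrt (d\<^sup>2 + 1 / real (Suc n))"
      by (rule real_less_rsqrt) simp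
    then obtain s where "s \<in> S" "dist x s < sqrt (d\<^sup>2 + 1 / real (Suc n))"
      using assms(1) unfolding d_def by (auto simp: infdist_notempty cINF_less_iff)
    then have "(dist x s)\<^sup>2 \<le> (sqrt (d\<^sup>2 + 1 / real (Suc n)))\<^sup>2"
      by (intro power_mono) auto
    then show "C n \<noteq> {}"
      using \<open>s \<in> S\<close> by (auto simp: C_def add_nonneg_nonneg)
  next
    fix m n :: nat
    assume "m \<le> n"
    then have "1 / real (Suc n) \<le> 1 / real (Suc m)"
      by (intro divide_left_mono) auto
    then show "C n \<subseteq> C m"
      by (force simp: C_def)
  next
    fix e :: real
    assume "e > 0"
    (* The parallelogram law bounds the squared diameter of C n by 4 / Suc n. *)
    then obtain n :: nat where n: "inverse (real (Suc n)) < e\<^sup>2 / 4"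
      using reals_Archimedean[of "e\<^sup>2 / 4"] by auto
    have "dist s t < e" if "s \<in> C n" "t \<in> C n" for s t
    proof -
      have "d \<le> dist x (midpoint s t)"
        using that assms(3) midpoint_in_convex unfolding d_def C_def by (intro infdist_le) auto
      then have "d\<^sup>2 \<le> (dist x (midpoint s t))\<^sup>2"
        using d0 by (rule power_mono)
      moreover have "(dist x s)\<^sup>2 \<le> d\<^sup>2 + inverse (real (Suc n))"
        "(dist x t)\<^sup>2 \<le> d\<^sup>2 + inverse (real (Suc n))"
        using that by (auto simp: C_def inverse_eq_divide)
      ultimately have "(dist s t)\<^sup>2 < e\<^sup>2"
        using n parallelogram_midpoint[of s t x] by linarith
      then show ?thesis
        using \<open>e > 0\<close> by (meson less_imp_le power_less_imp_less_base)
    qed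
    then show "\<exists>n. \<forall>s\<in>C n. \<forall>t\<in>C n. dist s t < e"
      by blast
  qed blast
  then obtain s where s: "s \<in> C n" for n
    by blast
  have "(dist x s)\<^sup>2 \<le> d\<^sup>2"
  proof (rule field_le_epsilon)
    fix e :: real
    assume "e > 0"
    then obtain n :: nat where "inverse (real (Suc n)) < e"
      using reals_Archimedean by blast
    then show "(dist x s)\<^sup>2 \<le> d\<^sup>2 + e"
      using s[of n] by (simp add: C_def inverse_eq_divide)
  qed
  then have "dist x s \<le> d"
    using d0 by (rule power2_le_imp_le)
  moreover have "s \<in> S"
    using s[of 0] by (simp add: C_def)
  ultimately show thesis
    using infdist_le[of s S x] that by (auto simp: d_def)
qed

section \<open>Strict convexity of powers of the norm\<close>

text \<open>
  By the mean value theorem the increments over the two halves of \<open>[a, b]\<close> are given by the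
  derivative \<open>p t\<^sup>p\<^sup>-\<^sup>1\<close> at a point of each half, and this derivative is strictly increasing.
\<close>

lemma powr_midpoint_less:
  fixes a b p :: real
  assumes "1 < p" "0 \<le> a" "a < b"
  shows "((a + b) / 2) powr p < (a powr p + b powr p) / 2"
proof -
  let ?m = "(a + b) / 2"
  have mvt: "\<exists>z. l < z \<and> z < r \<and> r powr p - l powr p = (r - l) * (p * z powr (p - 1))"
    if "0 \<le> l" "l < r" for l r :: real
  proof -
    have D: "((\<lambda>t. t powr p) has_real_derivative p * t powr (p - 1)) (at t)" if "l < t" for t
      using that \<open>0 \<le> l\<close> by (intro has_real_derivative_powr) auto
    have "continuous_on {l..r} (\<lambda>t. t powr p)"
      using assms(1) \<open>0 \<le> l\<close> by (intro continuous_on_powr' continuous_intros) auto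
    moreover have "(\<lambda>t. t powr p) differentiable at t" if "l < t" "t < r" for t
      using D[OF that(1)] real_differentiable_def by blast
    ultimately obtain k z where z: "l < z" "z < r" "DERIV (\<lambda>t. t powr p) z :> k"
      "r powr p - l powr p = (r - l) * k"
      using MVT[OF \<open>l < r\<close>, of "\<lambda>t. t powr p"] by blast
    then have "k = p * z powr (p - 1)"
      using D DERIV_unique by blast
    then show ?thesis
      using z by blast
  qed
  obtain y where y: "a < y" "y < ?m" "?m powr p - a powr p = (?m - a) * (p * y powr (p - 1))"
    using mvt[of a ?m] assms by auto
  obtain z where z: "?m < z" "z < b" "b powr p - ?m powr p = (b - ?m) * (p * z powr (p - 1))"
    using mvt[of ?m b] assms by auto
  have "y powr (p - 1) < z powr (p - 1)"
    using y z assms by (intro powr_less_mono2) auto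
  then have "(?m - a) * (p * y powr (p - 1)) < (?m - a) * (p * z powr (p - 1))"
    using assms by (intro mult_strict_left_mono) auto
  moreover have "b - ?m = ?m - a"
    by (simp add: field_simps)
  ultimately show ?thesis
    using y(3) z(3) by (simp add: field_simps)
qed

lemma norm_midpoint_less_of_eq_norm:
  fixes x y :: "'a::real_inner"
  assumes "norm x = norm y" "x \<noteq> y"
  shows "norm (midpoint x y) < norm x"
proof -
  have "(dist x y)\<^sup>2 > 0"
    using assms(2) by simp
  then have "(norm (midpoint x y))\<^sup>2 < (norm x)\<^sup>2"
    using parallelogram_midpoint[of x y 0] assms(1) by simp
  then show ?thesis
    by (meson norm_ge_zero power_less_imp_less_base)
qed

lemma norm_midpoint_le:
  fixes x y :: "'a::real_normed_vector"
  shows "norm (midpoint x y) \<le> (norm x + norm y) / 2"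
  using norm_triangle_ineq[of x y] by (simp add: midpoint_def)

lemma norm_midpoint_powr_less:
  fixes x y :: "'a::real_inner"
  assumes "1 < p" "x \<noteq> y"
  shows "norm (midpoint x y) powr p < (norm x powr p + norm y powr p) / 2"
proof (cases "norm x = norm y")
  case True
  then have "norm (midpoint x y) powr p < norm x powr p"
    using assms norm_midpoint_less_of_eq_norm[OF True] by (intro powr_less_mono2) auto
  then show ?thesis
    using True by simp
next
  case False
  have "norm (midpoint x y) powr p \<le> ((norm x + norm y) / 2) powr p"
    using assms norm_midpoint_le by (intro powr_mono2) auto
  also have "\<dots> < (norm x powr p + norm y powr p) / 2"
    using False powr_midpoint_less[OF assms(1), of "norm x" "norm y"]
      powr_midpoint_less[OF assms(1), of "norm y" "norm x"]
    by (cases "norm x < norm y") (auto simp: add.commute)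
  finally show ?thesis .
qed

section \<open>The weighted norm and feasible shifts\<close>

text \<open>
  All comparisons of weighted norms are made on their \<open>p\<close>-th powers, on which the outer root acts
  as a strictly increasing function.
\<close>

lemma weighted_pnorm_less_iff:
  fixes u v :: "'a::real_normed_vector ^ 'm::finite"
  assumes "\<And>i. 0 \<le> \<alpha> i" "0 < p"
  shows "weighted_pnorm \<alpha> p u < weighted_pnorm \<alpha> p v \<longleftrightarrow>
    (\<Sum>i\<in>UNIV. \<alpha> i * norm (u $ i) powr p) < (\<Sum>i\<in>UNIV. \<alpha> i * norm (v $ i) powr p)"
proof -
  have "0 \<le> (\<Sum>i\<in>UNIV. \<alpha> i * norm (w $ i) powr p)" for w :: "'a ^ 'm"
    using assms by (intro sum_nonneg) auto
  then show ?thesis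
    unfolding weighted_pnorm_def using assms(2)
    by (meson not_less powr_less_mono2 powr_mono2 zero_less_divide_1_iff less_imp_le)
qed

lemma sum_norm_midpoint_powr_less:
  fixes u v :: "'a::real_inner ^ 'm::finite"
  assumes "\<And>i. 0 < \<alpha> i" "1 < p" "u \<noteq> v"
  shows "(\<Sum>i\<in>UNIV. \<alpha> i * norm (midpoint u v $ i) powr p) <
    ((\<Sum>i\<in>UNIV. \<alpha> i * norm (u $ i) powr p) + (\<Sum>i\<in>UNIV. \<alpha> i * norm (v $ i) powr p)) / 2"
proof -
  let ?r = "\<lambda>i. \<alpha> i * ((norm (u $ i) powr p + norm (v $ i) powr p) / 2)"
  have component: "midpoint u v $ i = midpoint (u $ i) (v $ i)" for i
    by (simp add: midpoint_def)
  obtain j where j: "u $ j \<noteq> v $ j"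
    using assms(3) by (auto simp: vec_eq_iff)
  have less: "\<alpha> i * norm (midpoint u v $ i) powr p < ?r i" if "u $ i \<noteq> v $ i" for i
    unfolding component using assms that by (intro mult_strict_left_mono norm_midpoint_powr_less)
  have "\<alpha> i * norm (midpoint u v $ i) powr p \<le> ?r i" for i
    using less[of i] by (cases "u $ i = v $ i") (auto simp: component)
  then have "(\<Sum>i\<in>UNIV. \<alpha> i * norm (midpoint u v $ i) powr p) < (\<Sum>i\<in>UNIV. ?r i)"
    using less[OF j] by (intro sum_strict_mono_ex1) auto
  also have "\<dots> = ((\<Sum>i\<in>UNIV. \<alpha> i * norm (u $ i) powr p) +
      (\<Sum>i\<in>UNIV. \<alpha> i * norm (v $ i) powr p)) / 2"
    by (simp add: sum.distrib[symmetric] sum_divide_distrib distrib_left)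
  finally show ?thesis .
qed

lemma feasible_shifts_iff: "u \<in> feasible_shifts S \<longleftrightarrow> (\<exists>x. \<forall>i. x - u $ i \<in> S i)"
proof -
  have "x \<in> (\<lambda>s. s + u $ i) ` S i \<longleftrightarrow> x - u $ i \<in> S i" for x i
    by (force simp: image_iff)
  moreover have "u \<in> feasible_shifts S \<longleftrightarrow> (\<exists>x. \<forall>i. x \<in> (\<lambda>s. s + u $ i) ` S i)"
    unfolding feasible_shifts_def by blast
  ultimately show ?thesis
    by simp
qed

lemma midpoint_feasible_shifts:
  assumes "\<And>i. convex (S i)" "u \<in> feasible_shifts S" "v \<in> feasible_shifts S"
  shows "midpoint u v \<in> feasible_shifts S"
proof -
  obtain x y where "\<And>i. x - u $ i \<in> S i" "\<And>i. y - v $ i \<in> S i"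
    using assms(2,3) by (auto simp: feasible_shifts_iff)
  then have "midpoint (x - u $ i) (y - v $ i) \<in> S i" for i
    using assms(1) midpoint_in_convex by blast
  then have "midpoint x y - midpoint u v $ i \<in> S i" for i
    by (simp add: midpoint_def algebra_simps)
  then show ?thesis
    by (auto simp: feasible_shifts_iff)
qed

theorem corollary22:
  fixes S :: "'m::finite \<Rightarrow> 'a::{real_inner, complete_space} set"
    and \<alpha> :: "'m \<Rightarrow> real"
    and p :: real
  assumes "\<And>i. S i \<noteq> {}"
    and "\<And>i. closed (S i)"
    and "\<And>i. convex (S i)"
    and "(\<Inter>i. S i) = {}"
    and "\<And>i. \<alpha> i > 0"
    and "(\<Sum>i\<in>UNIV. \<alpha> i) = 1"
    and "(p > 1 \<and> CARD('m) = 2) \<or> p \<ge> 2"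
    and "\<exists>x. is_arg_min (distance_objective \<alpha> p S) (\<lambda>x. x \<in> UNIV) x"
  shows "\<exists>!u. is_arg_min (weighted_pnorm \<alpha> p) (\<lambda>u. u \<in> feasible_shifts S) u"
proof -
  let ?N = "\<lambda>u :: 'a ^ 'm. \<Sum>i\<in>UNIV. \<alpha> i * norm (u $ i) powr p"
  have p: "1 < p"
    using assms(7) by auto
  have arg_min_iff: "is_arg_min (weighted_pnorm \<alpha> p) (\<lambda>u. u \<in> feasible_shifts S) u \<longleftrightarrow>
      u \<in> feasible_shifts S \<and> (\<forall>v\<in>feasible_shifts S. ?N u \<le> ?N v)" for u
  proof -
    have "weighted_pnorm \<alpha> p v < weighted_pnorm \<alpha> p u \<longleftrightarrow> ?N v < ?N u" for v
      using p assms(5) by (intro weighted_pnorm_less_iff) (auto intro: less_imp_le)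
    then show ?thesis
      unfolding is_arg_min_def by (meson not_less)
  qed
  obtain x where x: "distance_objective \<alpha> p S x \<le> distance_objective \<alpha> p S y" for y
    using assms(8) by (auto simp: is_arg_min_def not_less)
  have "\<exists>s. s \<in> S i \<and> dist x s = infdist x (S i)" for i
    using nearest_point_exists[OF assms(1) assms(2) assms(3)] by blast
  then obtain s where s: "s i \<in> S i" "dist x (s i) = infdist x (S i)" for i
    by metis
  define u where "u = (\<chi> i. x - s i)"
  have "u \<in> feasible_shifts S"
    unfolding feasible_shifts_iff using s(1) by (intro exI[of _ x]) (simp add: u_def)
  moreover have "?N u \<le> ?N v" if "v \<in> feasible_shifts S" for v
  proof -
    obtain y where y: "y - v $ i \<in> S i" for i
      using \<open>v \<in> feasible_shifts S\<close> by (auto simp: feasible_shifts_iff)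
    have "?N u = distance_objective \<alpha> p S x"
      using s(2) by (simp add: u_def distance_objective_def dist_norm)
    also have "\<dots> \<le> distance_objective \<alpha> p S y"
      by (rule x)
    also have "\<dots> \<le> ?N v"
      unfolding distance_objective_def
    proof (intro sum_mono mult_left_mono powr_mono2)
      fix i
      show "infdist y (S i) \<le> norm (v $ i)"
        using infdist_le[OF y[of i], of y] by (simp add: dist_norm)
    qed (use p assms(5) in \<open>auto simp: infdist_nonneg less_imp_le\<close>)
    finally show ?thesis .
  qed
  moreover have "v = w"
    if v: "v \<in> feasible_shifts S" "\<forall>z\<in>feasible_shifts S. ?N v \<le> ?N z"
      and w: "w \<in> feasible_shifts S" "\<forall>z\<in>feasible_shifts S. ?N w \<le> ?N z" for v w
  proof (rule ccontr)
    assume "v \<noteq> w"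
    have "midpoint v w \<in> feasible_shifts S"
      by (rule midpoint_feasible_shifts) (use assms(3) v(1) w(1) in auto)
    then have "?N v \<le> ?N (midpoint v w)" "?N w \<le> ?N (midpoint v w)"
      using v(2) w(2) by (fast, fast)
    moreover have "?N (midpoint v w) < (?N v + ?N w) / 2"
      by (rule sum_norm_midpoint_powr_less[OF assms(5) p \<open>v \<noteq> w\<close>])
    ultimately show False
      by argo
  qed
  ultimately show ?thesis
    unfolding arg_min_iff by blast
qed

end
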